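(* Let $L\subset\mathbb C^n$ be a special Lagrangian submanifold (without boundary, closed as a subset of $\mathbb C^n$) which is asymptotic to a cone $\Lambda$, in the sense given in the context, and let $z_1,\dots,z_n$ be the coordinates on $\mathbb C^n$. Then for $\delta>0$ and $0<\theta<\frac{\pi}{2n}$, $L$ cannot be contained in the cone $$B_\theta^\delta=\{(z_1,\dots,z_n):\ z_1\in A_\theta,\ |z_1|>\delta|z_i| \text{ for all } i\},$$ where $A_\theta=\{re^{i\rho}: r>0,\ 0<\rho<\theta\}\subset\mathbb C$.
   Context: $\mathbb C^n$ has its standard Kähler form $\omega$ and holomorphic volume form $\varphi=dz_1\wedge\dots\wedge dz_n$; an $n$-dimensional submanifold $L$ is special Lagrangian if $\omega|_L=0$ and $\mathrm{Im}\,\varphi|_L=0$. Asymptotic to a cone: let $d$ be the distance to the origin restricted to $L$, $v=\nabla d$ (gradient on $L$) and $w=v/\|v\|^2$. It is required that, as $t\to\infty$, the rescaled links $\{z: |z|=1,\ tz\in L\}$ converge to the (compact) base $\Lambda\cap S^{2n-1}$ of the cone (in particular, their $(n-1)$-dimensional volumes stay bounded); that $w$ is well-defined outside some ball in $L$ with $\|w\|\to1$ at infinity; and that there is a function $g:\mathbb R_+\to\mathbb R_+$ with $\int_1^\infty \frac{g(t)}{t}\,dt<\infty$ such that the length of the component of $w(x)$ orthogonal to the line through $x$ and the origin is at most $g(\|x\|)$. *)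

theory Defs
  imports "HOL-Analysis.Analysis"
begin

section \<open>Smooth embedded submanifolds of a Euclidean space\<close>

text \<open>
  Intended for open \<open>S\<close> and a finite-dimensional domain, where requiring each directional
  derivative to be of class \<open>C\<^sup>k\<close> is the usual notion of class \<open>C\<^sup>k\<^sup>+\<^sup>1\<close>.
\<close>

primrec Ck_on :: "nat \<Rightarrow> ('a::real_normed_vector \<Rightarrow> 'b::real_normed_vector) \<Rightarrow> 'a set \<Rightarrow> bool"
  where
    "Ck_on 0 f S \<longleftrightarrow> continuous_on S f"
  | "Ck_on (Suc k) f S \<longleftrightarrow>
       (\<forall>x\<in>S. f differentiable (at x)) \<and> (\<forall>v. Ck_on k (\<lambda>x. frechet_derivative f (at x) v) S)"

definition smooth_on :: "'a set \<Rightarrow> ('a::real_normed_vector \<Rightarrow> 'b::real_normed_vector) \<Rightarrow> bool"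
  where "smooth_on S f \<longleftrightarrow> (\<forall>k. Ck_on k f S)"

text \<open>
  The dimension of the submanifold is that of the parameter space \<open>'m\<close>, passed as a type argument.
\<close>

definition embedded_submanifold ::
    "'m::euclidean_space itself \<Rightarrow> 'a::euclidean_space set \<Rightarrow> bool"
  where "embedded_submanifold _ L \<longleftrightarrow>
    (\<forall>p\<in>L. \<exists>U (V :: 'm set) \<phi> \<psi>.
        open U \<and> p \<in> U \<and> open V \<and>
        homeomorphism V (L \<inter> U) \<phi> \<psi> \<and>
        smooth_on V \<phi> \<and>
        (\<forall>x\<in>V. inj (frechet_derivative \<phi> (at x))))"

text \<open>
  Velocities of curves in \<open>L\<close>.  On an embedded submanifold, asking only for differentiability at
  \<open>0\<close> gives the same vectors as asking for smooth curves.
\<close>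

definition tangent_space :: "'a::euclidean_space set \<Rightarrow> 'a \<Rightarrow> 'a set"
  where "tangent_space L p =
    {v. \<exists>\<gamma>::real \<Rightarrow> 'a. \<gamma> 0 = p \<and> (\<forall>t. \<gamma> t \<in> L) \<and> (\<gamma> has_vector_derivative v) (at 0)}"

text \<open>
  The gradient on \<open>L\<close>, for the induced metric, of the restriction to \<open>L\<close> of a function \<open>f\<close> that is
  defined and differentiable near \<open>p\<close> in the ambient space.
\<close>

definition grad_on :: "'a::euclidean_space set \<Rightarrow> ('a \<Rightarrow> real) \<Rightarrow> 'a \<Rightarrow> 'a"
  where "grad_on L f p =
    (THE v. v \<in> tangent_space L p \<and>
            (\<forall>u\<in>tangent_space L p. v \<bullet> u = frechet_derivative f (at p) u))"

section \<open>Special Lagrangian submanifolds\<close>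

text \<open>
  \<open>\<omega> = (\<i>/2) \<Sum> dz\<^sub>i \<and> d(cnj z\<^sub>i) = \<Sum> dx\<^sub>i \<and> dy\<^sub>i\<close>
\<close>

definition kaehler_form :: "complex ^ 'n \<Rightarrow> complex ^ 'n \<Rightarrow> real"
  where "kaehler_form u v = (\<Sum>i\<in>UNIV. Re (u $ i) * Im (v $ i) - Im (u $ i) * Re (v $ i))"

text \<open>
  \<open>dz\<^sub>1 \<and> \<dots> \<and> dz\<^sub>n\<close>.  The same index type numbers the coordinates and the vectors, so no
  ordering of it has to be chosen.
\<close>

definition holomorphic_volume_form :: "('n \<Rightarrow> complex ^ 'n) \<Rightarrow> complex"
  where "holomorphic_volume_form v = det (\<chi> i j. v j $ i)"

definition special_lagrangian :: "(complex ^ 'n) set \<Rightarrow> bool"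
  where "special_lagrangian L \<longleftrightarrow>
    embedded_submanifold TYPE(real ^ 'n) L \<and>
    (\<forall>p\<in>L. \<forall>u\<in>tangent_space L p. \<forall>v\<in>tangent_space L p. kaehler_form u v = 0) \<and>
    (\<forall>p\<in>L. \<forall>v. (\<forall>i. v i \<in> tangent_space L p) \<longrightarrow> Im (holomorphic_volume_form v) = 0)"

section \<open>Hausdorff measure\<close>

text \<open>
  Normalised so as to agree with Riemannian volume on \<open>m\<close>-dimensional submanifolds.  Empty
  covering sets are singled out so that the case \<open>m = 0\<close> is the counting measure.
\<close>

definition hausdorff_content :: "nat \<Rightarrow> real \<Rightarrow> 'a::metric_space set \<Rightarrow> ennreal"
  where "hausdorff_content m \<epsilon> A =
    (INF C \<in> {C :: nat \<Rightarrow> 'a set. A \<subseteq> (\<Union>i. C i) \<and> (\<forall>i. bounded (C i) \<and> diameter (C i) \<le> \<epsilon>)}.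
       \<Sum>i. if C i = {} then 0
           else ennreal (unit_ball_vol (real m) * (diameter (C i) / 2) ^ m))"

definition hausdorff_measure :: "nat \<Rightarrow> 'a::metric_space set \<Rightarrow> ennreal"
  where "hausdorff_measure m A = (SUP \<epsilon> \<in> {0<..}. hausdorff_content m \<epsilon> A)"

section \<open>Submanifolds asymptotic to a cone\<close>

definition hausdorff_tendsto :: "('i \<Rightarrow> 'a::metric_space set) \<Rightarrow> 'a set \<Rightarrow> 'i filter \<Rightarrow> bool"
  where "hausdorff_tendsto A B F \<longleftrightarrow>
    (\<forall>\<epsilon>>0. \<forall>\<^sub>F t in F. A t \<subseteq> (\<Union>b\<in>B. ball b \<epsilon>) \<and> B \<subseteq> (\<Union>a\<in>A t. ball a \<epsilon>))"

definition rescaled_link :: "'a::euclidean_space set \<Rightarrow> real \<Rightarrow> 'a set"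
  where "rescaled_link L t = {z. norm z = 1 \<and> t *\<^sub>R z \<in> L}"

definition radial_field :: "'a::euclidean_space set \<Rightarrow> 'a \<Rightarrow> 'a"
  where "radial_field L x = (let v = grad_on L norm x in v /\<^sub>R (norm v)\<^sup>2)"

definition normal_part :: "'a::euclidean_space \<Rightarrow> 'a \<Rightarrow> 'a"
  where "normal_part x u = u - ((u \<bullet> x) / (x \<bullet> x)) *\<^sub>R x"

text \<open>
  The links are required to converge to the base in the Hausdorff distance and, separately, to have
  bounded \<open>(n - 1)\<close>-dimensional volume; the latter would follow from \<open>C\<^sup>1\<close> convergence.
  The field \<open>w\<close> is well-defined at \<open>x\<close> when the gradient there does not vanish.
\<close>

definition asymptotic_to_cone :: "(complex ^ 'n) set \<Rightarrow> (complex ^ 'n) set \<Rightarrow> bool"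
  where "asymptotic_to_cone L \<Lambda> \<longleftrightarrow>
    cone \<Lambda> \<and> compact (\<Lambda> \<inter> sphere 0 1) \<and>
    hausdorff_tendsto (rescaled_link L) (\<Lambda> \<inter> sphere 0 1) at_top \<and>
    (\<exists>C::real. \<forall>\<^sub>F t in at_top.
        hausdorff_measure (CARD('n) - 1) (rescaled_link L t) \<le> ennreal C) \<and>
    ((\<lambda>x. norm (radial_field L x)) \<longlongrightarrow> 1) (inf at_infinity (principal L)) \<and>
    (\<exists>R>0. (\<forall>x\<in>L. norm x > R \<longrightarrow> grad_on L norm x \<noteq> 0) \<and>
      (\<exists>g :: real \<Rightarrow> real. (\<forall>t>0. g t \<ge> 0) \<and>
         (\<lambda>t. g t / t) absolutely_integrable_on {1..} \<and>
         (\<forall>x\<in>L. norm x > R \<longrightarrow> norm (normal_part x (radial_field L x)) \<le> g (norm x))))"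

section \<open>The cones that are to be excluded\<close>

definition sector :: "real \<Rightarrow> complex set"
  where "sector \<theta> = {rcis r \<rho> | r \<rho>. r > 0 \<and> 0 < \<rho> \<and> \<rho> < \<theta>}"

text \<open>
  The index \<open>k\<close> plays the role of the first coordinate.
\<close>

definition cone_region :: "'n \<Rightarrow> real \<Rightarrow> real \<Rightarrow> (complex ^ 'n) set"
  where "cone_region k \<theta> \<delta> =
    {z. z $ k \<in> sector \<theta> \<and> (\<forall>i. cmod (z $ k) > \<delta> * cmod (z $ i))}"

end

theory Submission
  imports Defs
begin

text \<open>
  On the cone, \<open>x = Re z\<^sub>k\<close> dominates \<open>|z|\<close>, so \<open>x\<close> is proper and bounded below on the closed set \<open>L\<close>.
  Hence for small \<open>\<epsilon> > 0\<close> the function \<open>x - \<epsilon> |z|\<^sup>2\<close> has a local minimum on \<open>L\<close>.  But a special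
  Lagrangian submanifold is minimal, so linear functions are harmonic on it and the Laplacian of
  \<open>x - \<epsilon> |z|\<^sup>2\<close> on \<open>L\<close> is \<open>- 2 n \<epsilon> < 0\<close>, which excludes local minima.

  Minimality is obtained in a chart \<open>\<phi>\<close>.  Since \<open>\<omega>\<close> vanishes on \<open>L\<close>, the cubic form
  \<open>\<omega>(\<partial>\<^sub>i\<partial>\<^sub>k\<phi>, \<partial>\<^sub>j\<phi>)\<close> is totally symmetric; since the phase of \<open>dz\<^sub>1 \<and> \<dots> \<and> dz\<^sub>n\<close> is constant on \<open>L\<close>, its
  trace vanishes.  So \<open>\<Sum>\<^sub>i \<partial>\<^sub>i\<partial>\<^sub>i\<phi>\<close>, in coordinates orthonormal at the point, is tangent to \<open>L\<close>.
\<close>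

section \<open>Symmetry of second derivatives\<close>

text \<open>Two applications of the mean value theorem: first along \<open>b\<close>, to the
  increment of \<open>f\<close> in direction \<open>c\<close>, then along \<open>c\<close>, to
  \<open>f' _ b\<close>. The mixed difference itself is unchanged when \<open>b\<close> and
  \<open>c\<close> are swapped, and this is what forces second derivatives to commute.\<close>

lemma mixed_difference_mvt:
  fixes f :: "'a::real_normed_vector \<Rightarrow> real"
  assumes "0 < s"
    and in_V: "\<And>t u. \<lbrakk>0 \<le> t; t \<le> s; 0 \<le> u; u \<le> s\<rbrakk> \<Longrightarrow> x + t *\<^sub>R b + u *\<^sub>R c \<in> V"
    and f': "\<And>y. y \<in> V \<Longrightarrow> (f has_derivative f' y) (at y)"
    and f'': "\<And>y. y \<in> V \<Longrightarrow> ((\<lambda>z. f' z b) has_derivative f'' y) (at y)"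
  obtains y where "dist y x \<le> s * (norm b + norm c)"
    and "f (x + s *\<^sub>R b + s *\<^sub>R c) - f (x + s *\<^sub>R b) - f (x + s *\<^sub>R c) + f x = s * s * f'' y c"
proof -
  let ?g = "\<lambda>t. f (x + t *\<^sub>R b + s *\<^sub>R c) - f (x + t *\<^sub>R b)"
  let ?g' = "\<lambda>t. f' (x + t *\<^sub>R b + s *\<^sub>R c) b - f' (x + t *\<^sub>R b) b"
  have "(?g has_real_derivative ?g' t) (at t)" if "0 \<le> t" "t \<le> s" for t
  proof -
    have d: "((\<lambda>r. f (x + r *\<^sub>R b + u *\<^sub>R c)) has_derivative (\<lambda>h. f' (x + t *\<^sub>R b + u *\<^sub>R c) (h *\<^sub>R b))) (at t)"
      if "0 \<le> u" "u \<le> s" for u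
      by (rule has_derivative_compose[where g = f, OF _ f'])
        (use in_V \<open>0 \<le> t\<close> \<open>t \<le> s\<close> that in \<open>auto intro!: derivative_eq_intros\<close>)
    have lin: "f' (x + t *\<^sub>R b + u *\<^sub>R c) (h *\<^sub>R b) = f' (x + t *\<^sub>R b + u *\<^sub>R c) b * h"
      if "0 \<le> u" "u \<le> s" for u h
      using linear_scale[OF has_derivative_linear[OF f'[OF in_V]], of t u h b] \<open>0 \<le> t\<close> \<open>t \<le> s\<close> that
      by (simp add: mult.commute)
    have dd: "((\<lambda>r. f (x + r *\<^sub>R b + u *\<^sub>R c)) has_real_derivative f' (x + t *\<^sub>R b + u *\<^sub>R c) b) (at t)"
      if "0 \<le> u" "u \<le> s" for u
      using d[OF that] unfolding has_field_derivative_def lin[OF that] .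
    show ?thesis
      using DERIV_diff[OF dd[of s] dd[of 0]] \<open>0 < s\<close> by simp
  qed
  from MVT2[OF \<open>0 < s\<close> this]
  obtain \<xi> where \<xi>: "0 < \<xi>" "\<xi> < s" and g: "?g s - ?g 0 = s * ?g' \<xi>"
    by auto
  have "((\<lambda>u. f' (x + \<xi> *\<^sub>R b + u *\<^sub>R c) b) has_real_derivative f'' (x + \<xi> *\<^sub>R b + u *\<^sub>R c) c) (at u)"
    if "0 \<le> u" "u \<le> s" for u
  proof -
    have V: "x + \<xi> *\<^sub>R b + u *\<^sub>R c \<in> V" using in_V \<xi> that by simp
    have "((\<lambda>u. f' (x + \<xi> *\<^sub>R b + u *\<^sub>R c) b) has_derivative
        (\<lambda>h. f'' (x + \<xi> *\<^sub>R b + u *\<^sub>R c) (h *\<^sub>R c))) (at u)"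
      by (rule has_derivative_compose[where g = "\<lambda>z. f' z b", OF _ f'']) (use V in \<open>auto intro!: derivative_eq_intros\<close>)
    moreover have "f'' (x + \<xi> *\<^sub>R b + u *\<^sub>R c) (h *\<^sub>R c) = f'' (x + \<xi> *\<^sub>R b + u *\<^sub>R c) c * h" for h
      using linear_scale[OF has_derivative_linear[OF f''[OF V]], of h c] by (simp add: mult.commute)
    ultimately show ?thesis
      unfolding has_field_derivative_def by simp
  qed
  from MVT2[OF \<open>0 < s\<close> this]
  obtain \<eta> where \<eta>: "0 < \<eta>" "\<eta> < s" and g': "?g' \<xi> = s * f'' (x + \<xi> *\<^sub>R b + \<eta> *\<^sub>R c) c"
    by auto
  show thesis
  proof
    have "norm (\<xi> *\<^sub>R b + \<eta> *\<^sub>R c) \<le> \<xi> * norm b + \<eta> * norm c"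
      using \<xi> \<eta> norm_triangle_ineq[of "\<xi> *\<^sub>R b" "\<eta> *\<^sub>R c"] by simp
    also have "\<dots> \<le> s * (norm b + norm c)"
      unfolding distrib_left using \<xi> \<eta> by (intro add_mono mult_right_mono) auto
    finally show "dist (x + \<xi> *\<^sub>R b + \<eta> *\<^sub>R c) x \<le> s * (norm b + norm c)"
      by (simp add: dist_norm algebra_simps)
    show "f (x + s *\<^sub>R b + s *\<^sub>R c) - f (x + s *\<^sub>R b) - f (x + s *\<^sub>R c) + f x =
        s * s * f'' (x + \<xi> *\<^sub>R b + \<eta> *\<^sub>R c) c"
      using g unfolding g' by simp
  qed
qed

text \<open>The same mixed difference is written in both orders, so the two second derivatives agree
  at points \<open>y\<close> and \<open>z\<close> arbitrarily close to \<open>x\<close>; continuity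
  at \<open>x\<close> then leaves no room for a gap of size \<open>2 * e\<close>. The hypotheses are
  stated one direction at a time because \<open>Ck_on\<close> supplies derivatives in that
  form.\<close>

lemma symmetric_second_derivative_real:
  fixes f :: "'a::real_normed_vector \<Rightarrow> real"
  assumes "open V" "x \<in> V"
    and f': "\<And>y. y \<in> V \<Longrightarrow> (f has_derivative f' y) (at y)"
    and f'': "\<And>v y. y \<in> V \<Longrightarrow> ((\<lambda>z. f' z v) has_derivative f'' v y) (at y)"
    and cont: "\<And>u v. continuous_on V (\<lambda>y. f'' v y u)"
  shows "f'' b x c = f'' c x b"
proof (rule ccontr)
  define e where "e = \<bar>f'' b x c - f'' c x b\<bar> / 2"
  assume "f'' b x c \<noteq> f'' c x b"
  then have "e > 0" by (simp add: e_def)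
  have near: "\<exists>d>0. \<forall>y. dist y x < d \<longrightarrow> dist (f'' v y u) (f'' v x u) < e" for u v
  proof -
    have "isCont (\<lambda>y. f'' v y u) x"
      using cont[of v u] \<open>open V\<close> \<open>x \<in> V\<close> continuous_on_eq_continuous_at by blast
    then show ?thesis using \<open>e > 0\<close> unfolding continuous_at_eps_delta by blast
  qed
  obtain d1 d2 d3 where d: "d1 > 0" "d2 > 0" "d3 > 0"
    and d1: "\<And>y. dist y x < d1 \<Longrightarrow> dist (f'' b y c) (f'' b x c) < e"
    and d2: "\<And>y. dist y x < d2 \<Longrightarrow> dist (f'' c y b) (f'' c x b) < e"
    and d3: "ball x d3 \<subseteq> V"
  proof -
    obtain d1 where "d1 > 0" "\<And>y. dist y x < d1 \<Longrightarrow> dist (f'' b y c) (f'' b x c) < e"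
      using near[of b c] by blast
    moreover obtain d2 where "d2 > 0" "\<And>y. dist y x < d2 \<Longrightarrow> dist (f'' c y b) (f'' c x b) < e"
      using near[of c b] by blast
    moreover obtain d3 where "d3 > 0" "ball x d3 \<subseteq> V"
      using openE[OF \<open>open V\<close> \<open>x \<in> V\<close>] .
    ultimately show thesis by (intro that)
  qed
  define m where "m = Min {d1, d2, d3}"
  \<comment> \<open>The parallelogram with sides \<open>s *\<^sub>R b\<close> and
    \<open>s *\<^sub>R c\<close> then stays within distance \<open>m\<close> of \<open>x\<close>;
    the summand 1 avoids division by zero when both vectors vanish.\<close>
  define s where "s = m / (norm b + norm c + 1)"
  have "m > 0" and md: "m \<le> d1" "m \<le> d2" "m \<le> d3" using d by (auto simp: m_def)
  have pos: "norm b + norm c + 1 > 0" by (simp add: add_nonneg_pos)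
  then have "s > 0" using \<open>m > 0\<close> by (simp add: s_def)
  have "s * (norm b + norm c) < s * (norm b + norm c + 1)" using \<open>s > 0\<close> by simp
  also have "\<dots> = m" using pos by (simp add: s_def)
  finally have sm: "s * (norm b + norm c) < m" .
  have in_V: "x + t *\<^sub>R b + u *\<^sub>R c \<in> V" if "0 \<le> t" "t \<le> s" "0 \<le> u" "u \<le> s" for t u
  proof -
    have "norm (t *\<^sub>R b + u *\<^sub>R c) \<le> t * norm b + u * norm c"
      using that norm_triangle_ineq[of "t *\<^sub>R b" "u *\<^sub>R c"] by simp
    also have "\<dots> \<le> s * (norm b + norm c)"
      unfolding distrib_left using that by (intro add_mono mult_right_mono) auto
    also have "\<dots> < d3" using sm md by simp
    finally have "dist (x + (t *\<^sub>R b + u *\<^sub>R c)) x < d3"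
      by (simp add: dist_norm)
    then have "x + (t *\<^sub>R b + u *\<^sub>R c) \<in> ball x d3"
      by (simp only: mem_ball dist_commute)
    then show ?thesis using d3 by (auto simp: add.assoc)
  qed
  have in_V': "x + t *\<^sub>R c + u *\<^sub>R b \<in> V" if "0 \<le> t" "t \<le> s" "0 \<le> u" "u \<le> s" for t u
    using in_V[of u t] that by (simp add: algebra_simps)
  obtain y where y: "dist y x \<le> s * (norm b + norm c)"
    "f (x + s *\<^sub>R b + s *\<^sub>R c) - f (x + s *\<^sub>R b) - f (x + s *\<^sub>R c) + f x = s * s * f'' b y c"
    by (rule mixed_difference_mvt[where f' = f' and f'' = "f'' b", OF \<open>s > 0\<close> in_V f' f''])
  obtain z where z: "dist z x \<le> s * (norm c + norm b)"
    "f (x + s *\<^sub>R c + s *\<^sub>R b) - f (x + s *\<^sub>R c) - f (x + s *\<^sub>R b) + f x = s * s * f'' c z b"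
    by (rule mixed_difference_mvt[where f' = f' and f'' = "f'' c", OF \<open>s > 0\<close> in_V' f' f''])
  have "s * s * f'' b y c = s * s * f'' c z b"
    using y(2) z(2) by (simp add: algebra_simps)
  then have "f'' b y c = f'' c z b" using \<open>s > 0\<close> by simp
  moreover have "dist (f'' b y c) (f'' b x c) < e" "dist (f'' c z b) (f'' c x b) < e"
    using d1[of y] d2[of z] y(1) z(1) sm md by (auto simp: add.commute)
  ultimately have "\<bar>f'' b x c - f'' c x b\<bar> < 2 * e"
    unfolding dist_real_def by arith
  then show False by (simp add: e_def)
qed

lemma symmetric_second_derivative:
  fixes f :: "'a::real_normed_vector \<Rightarrow> 'b::real_inner"
  assumes "open V" "x \<in> V"
    and f': "\<And>y. y \<in> V \<Longrightarrow> (f has_derivative f' y) (at y)"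
    and f'': "\<And>v y. y \<in> V \<Longrightarrow> ((\<lambda>z. f' z v) has_derivative f'' v y) (at y)"
    and cont: "\<And>u v. continuous_on V (\<lambda>y. f'' v y u)"
  shows "f'' b x c = f'' c x b"
proof -
  have "w \<bullet> f'' b x c = w \<bullet> f'' c x b" for w
  proof (rule symmetric_second_derivative_real[OF assms(1,2), where f = "\<lambda>y. w \<bullet> f y"
        and f' = "\<lambda>y u. w \<bullet> f' y u" and f'' = "\<lambda>v y u. w \<bullet> f'' v y u"])
    show "((\<lambda>y. w \<bullet> f y) has_derivative (\<lambda>u. w \<bullet> f' y u)) (at y)" if "y \<in> V" for y
      by (rule has_derivative_inner_right[OF f'[OF that]])
    show "((\<lambda>z. w \<bullet> f' z v) has_derivative (\<lambda>u. w \<bullet> f'' v y u)) (at y)" if "y \<in> V" for v y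
      by (rule has_derivative_inner_right[OF f''[OF that]])
    show "continuous_on V (\<lambda>y. w \<bullet> f'' v y u)" for u v
      by (intro continuous_intros cont)
  qed
  then show ?thesis using vector_eq_ldot[of "f'' b x c" "f'' c x b"] by blast
qed

section \<open>Linear algebra of Lagrangian frames\<close>

lemma kaehler_form_add_left: "kaehler_form (u + u') v = kaehler_form u v + kaehler_form u' v"
  by (simp add: kaehler_form_def algebra_simps sum.distrib sum_subtractf)

lemma kaehler_form_commute: "kaehler_form u v = - kaehler_form v u"
  by (simp add: kaehler_form_def algebra_simps sum_subtractf flip: sum_negf)

lemma kaehler_form_sum_left: "kaehler_form (sum f A) v = (\<Sum>i\<in>A. kaehler_form (f i) v)"
  by (induction A rule: infinite_finite_induct)
    (auto simp: kaehler_form_add_left, simp_all add: kaehler_form_def)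

definition hermitian :: "complex ^ 'n \<Rightarrow> complex ^ 'n \<Rightarrow> complex"
  where "hermitian u v = (\<Sum>l\<in>UNIV. u $ l * cnj (v $ l))"

lemma hermitian_eq: "hermitian u v = Complex (u \<bullet> v) (- kaehler_form u v)"
  by (rule complex_eqI)
    (simp_all add: hermitian_def kaehler_form_def inner_vec_def inner_complex_def algebra_simps
      sum.distrib sum_subtractf)

text \<open>Orthonormality and vanishing of \<omega> are the real and imaginary parts of one
  condition: the frame is unitary for \<open>hermitian\<close>. The conjugate transpose is therefore
  a left inverse of the frame matrix, and for square matrices also a right inverse.\<close>

lemma unitary_frame_inverse:
  fixes e :: "'n \<Rightarrow> complex ^ 'n"
  assumes orth: "\<And>i j. e i \<bullet> e j = (if i = j then 1 else 0)"
    and lag: "\<And>i j. kaehler_form (e i) (e j) = 0"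
  shows "(\<chi> i j. e j $ i) ** (\<chi> i j. cnj (e i $ j)) = mat 1"
proof -
  have "hermitian (e i) (e j) = (if i = j then 1 else 0)" for i j
    by (simp add: hermitian_eq orth lag complex_eq_iff)
  then have "(\<chi> i j. cnj (e i $ j)) ** (\<chi> i j. e j $ i) = mat 1"
    unfolding vec_eq_iff matrix_matrix_mult_def mat_def hermitian_def
    by (simp add: mult.commute)
  then show ?thesis
    by (simp add: matrix_left_right_inverse)
qed

lemma unitary_frame_expansion:
  fixes e :: "'n \<Rightarrow> complex ^ 'n"
  assumes orth: "\<And>i j. e i \<bullet> e j = (if i = j then 1 else 0)"
    and lag: "\<And>i j. kaehler_form (e i) (e j) = 0"
  shows "(\<chi> i j. e j $ i) *v (\<chi> j. hermitian u (e j)) = u"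
proof -
  have "(\<chi> j. hermitian u (e j)) = (\<chi> i j. cnj (e i $ j)) *v u"
    by (simp add: vec_eq_iff matrix_vector_mult_def hermitian_def mult.commute)
  then show ?thesis
    by (simp add: matrix_vector_mul_assoc unitary_frame_inverse[OF orth lag])
qed

lemma lagrangian_frame_complement:
  fixes e :: "'n \<Rightarrow> complex ^ 'n"
  assumes orth: "\<And>i j. e i \<bullet> e j = (if i = j then 1 else 0)"
    and lag: "\<And>i j. kaehler_form (e i) (e j) = 0"
    and N: "\<And>i. N \<bullet> e i = 0" and A: "\<And>i. kaehler_form A (e i) = 0"
  shows "N \<bullet> A = 0"
proof -
  \<comment> \<open>a Lagrangian subspace is its own \<open>\<omega>\<close>-complement, so \<open>A\<close> lies in the span of the frame\<close>
  have A_eq: "A $ l = (\<Sum>j\<in>UNIV. e j $ l * complex_of_real (A \<bullet> e j))" for l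
    using arg_cong[OF unitary_frame_expansion[OF orth lag, of A], of "\<lambda>w. w $ l"]
    by (simp add: matrix_vector_mult_def hermitian_eq A Complex_eq)
  have "A = (\<Sum>j\<in>UNIV. (A \<bullet> e j) *\<^sub>R e j)"
    by (simp add: vec_eq_iff A_eq scaleR_conv_of_real[where 'a = complex] mult.commute)
  then have "N \<bullet> A = N \<bullet> (\<Sum>j\<in>UNIV. (A \<bullet> e j) *\<^sub>R e j)" by simp
  then show ?thesis by (simp add: inner_sum_right N)
qed

text \<open>Cramer's rule: the Hermitian products with the frame are the complex coordinates of
  \<open>u\<close>, and replacing column \<open>k\<close> scales the determinant by the
  \<open>k\<close>-th of them.\<close>

lemma holomorphic_volume_form_upd:
  fixes e :: "'n \<Rightarrow> complex ^ 'n"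
  assumes orth: "\<And>i j. e i \<bullet> e j = (if i = j then 1 else 0)"
    and lag: "\<And>i j. kaehler_form (e i) (e j) = 0"
  shows "holomorphic_volume_form (e(k := u)) = hermitian u (e k) * holomorphic_volume_form e"
proof -
  let ?M = "(\<chi> i j. e j $ i) :: complex ^ 'n ^ 'n"
  let ?x = "(\<chi> j. hermitian u (e j)) :: complex ^ 'n"
  have "(\<chi> i j. (e(k := u)) j $ i) = (\<chi> i j. if j = k then (?M *v ?x) $ i else ?M $ i $ j)"
    by (simp add: unitary_frame_expansion[OF orth lag] vec_eq_iff)
  then have "holomorphic_volume_form (e(k := u)) =
      det (\<chi> i j. if j = k then (?M *v ?x) $ i else ?M $ i $ j)"
    by (simp only: holomorphic_volume_form_def)
  also have "\<dots> = ?x $ k * det ?M" by (rule cramer_lemma)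
  finally show ?thesis by (simp add: holomorphic_volume_form_def)
qed

lemma holomorphic_volume_form_frame_nonzero:
  fixes e :: "'n \<Rightarrow> complex ^ 'n"
  assumes orth: "\<And>i j. e i \<bullet> e j = (if i = j then 1 else 0)"
    and lag: "\<And>i j. kaehler_form (e i) (e j) = 0"
  shows "holomorphic_volume_form e \<noteq> 0"
proof -
  have "holomorphic_volume_form e * det ((\<chi> i j. cnj (e i $ j)) :: complex ^ 'n ^ 'n) = 1"
    unfolding holomorphic_volume_form_def det_mul[symmetric] unitary_frame_inverse[OF orth lag]
    by simp
  then show ?thesis by auto
qed

section \<open>Derivatives of the two forms\<close>

text \<open>The product rule for a multilinear map: one vector at a time is replaced by its
  derivative.\<close>

lemma has_derivative_holomorphic_volume_form:
  fixes e :: "'n \<Rightarrow> 'a::real_normed_vector \<Rightarrow> complex ^ 'n"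
  assumes "\<And>i. (e i has_derivative e' i) (at x)"
  shows "((\<lambda>y. holomorphic_volume_form (\<lambda>i. e i y)) has_derivative
      (\<lambda>h. \<Sum>k\<in>UNIV. holomorphic_volume_form ((\<lambda>i. e i x)(k := e' k h)))) (at x)"
proof -
  let ?S = "{p. p permutes (UNIV :: 'n set)}"
  \<comment> \<open>The Leibniz formula is taken for the transpose, so that each factor is indexed
    by the vector it comes from and \<open>has_derivative_prod\<close> differentiates exactly that
    vector.\<close>
  have col: "holomorphic_volume_form v = (\<Sum>p\<in>?S. of_int (sign p) * (\<Prod>i\<in>UNIV. v i $ p i))"
    for v :: "'n \<Rightarrow> complex ^ 'n"
    unfolding holomorphic_volume_form_def det_transpose[symmetric, of "\<chi> i j. v j $ i"]
    by (simp add: det_def transpose_def)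
  have comp: "((\<lambda>y. e i y $ l) has_derivative (\<lambda>h. e' i h $ l)) (at x)" for i l
    using bounded_linear.has_derivative[OF bounded_linear_vec_nth assms] .
  have "(\<Sum>k\<in>UNIV. holomorphic_volume_form ((\<lambda>i. e i x)(k := e' k h))) =
      (\<Sum>p\<in>?S. of_int (sign p) * (\<Sum>k\<in>UNIV. e' k h $ p k * (\<Prod>i\<in>UNIV - {k}. e i x $ p i)))" for h
  proof -
    have "(\<Prod>i\<in>UNIV. ((\<lambda>i. e i x)(k := e' k h)) i $ p i) =
        e' k h $ p k * (\<Prod>i\<in>UNIV - {k}. e i x $ p i)" for k p
      by (subst prod.remove[of _ k]) (auto intro!: prod.cong)
    then show ?thesis
      unfolding col by (subst sum.swap) (simp add: sum_distrib_left)
  qed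
  then have expand: "(\<lambda>h. \<Sum>k\<in>UNIV. holomorphic_volume_form ((\<lambda>i. e i x)(k := e' k h))) =
      (\<lambda>h. \<Sum>p\<in>?S. of_int (sign p) * (\<Sum>k\<in>UNIV. e' k h $ p k * (\<Prod>i\<in>UNIV - {k}. e i x $ p i)))"
    by (rule ext)
  show ?thesis
    unfolding expand unfolding col
    by (intro has_derivative_sum has_derivative_mult_right has_derivative_prod comp)
qed

lemma has_derivative_kaehler_form:
  assumes f: "(f has_derivative f') (at x)" and g: "(g has_derivative g') (at x)"
  shows "((\<lambda>y. kaehler_form (f y) (g y)) has_derivative
      (\<lambda>h. kaehler_form (f x) (g' h) + kaehler_form (f' h) (g x))) (at x)"
proof -
  have comp: "((\<lambda>y. Re (e y $ i)) has_derivative (\<lambda>h. Re (e' h $ i))) (at x)"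
    "((\<lambda>y. Im (e y $ i)) has_derivative (\<lambda>h. Im (e' h $ i))) (at x)"
    if "(e has_derivative e') (at x)" for e e' i
    using bounded_linear.has_derivative[OF bounded_linear_vec_nth that]
    by (auto intro: bounded_linear.has_derivative[OF bounded_linear_Re]
        bounded_linear.has_derivative[OF bounded_linear_Im])
  have "((\<lambda>y. Re (f y $ i) * Im (g y $ i) - Im (f y $ i) * Re (g y $ i)) has_derivative
      (\<lambda>h. (Re (f x $ i) * Im (g' h $ i) + Re (f' h $ i) * Im (g x $ i)) -
        (Im (f x $ i) * Re (g' h $ i) + Im (f' h $ i) * Re (g x $ i)))) (at x)" for i
    by (intro has_derivative_diff has_derivative_mult comp[OF f] comp[OF g])
  from has_derivative_sum[where I = UNIV, OF this] show ?thesis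
    unfolding kaehler_form_def
    by (rule has_derivative_eq_rhs)
      (simp add: fun_eq_iff algebra_simps flip: sum.distrib)
qed

lemma has_derivative_locally_zero:
  assumes "open V" "x \<in> V" "(f has_derivative f') (at x)" "\<And>y. y \<in> V \<Longrightarrow> f y = 0"
  shows "f' h = 0"
proof -
  have "(f has_derivative (\<lambda>_. 0)) (at x)"
    by (rule has_derivative_transform_within_open[where f = "\<lambda>_. 0"])
      (use assms in auto)
  from has_derivative_unique[OF assms(3) this] show ?thesis by simp
qed

section \<open>Mean curvature of special Lagrangian submanifolds\<close>

text \<open>\<open>D2 v y u\<close> is the derivative of \<open>D _ v\<close> in direction
  \<open>u\<close>. The directions \<open>b i\<close> are fixed parameter vectors, so
  differentiating produces no terms from a moving frame; the images are orthonormal only at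
  \<open>x\<close>, where the resulting identities are evaluated.\<close>

lemma special_lagrangian_mean_curvature_tangent:
  fixes \<phi> :: "'a::real_normed_vector \<Rightarrow> complex ^ 'n" and b :: "'n \<Rightarrow> 'a"
  assumes "open V" "x \<in> V"
    and D: "\<And>y. y \<in> V \<Longrightarrow> (\<phi> has_derivative D y) (at y)"
    and D2: "\<And>v y. y \<in> V \<Longrightarrow> ((\<lambda>z. D z v) has_derivative D2 v y) (at y)"
    and cont: "\<And>u v. continuous_on V (\<lambda>y. D2 v y u)"
    and lag: "\<And>y u v. y \<in> V \<Longrightarrow> kaehler_form (D y u) (D y v) = 0"
    and special: "\<And>y v. y \<in> V \<Longrightarrow> Im (holomorphic_volume_form (\<lambda>i. D y (v i))) = 0"
    and orth: "\<And>i j. D x (b i) \<bullet> D x (b j) = (if i = j then 1 else 0)"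
  shows "kaehler_form (\<Sum>i\<in>UNIV. D2 (b i) x (b i)) (D x (b k)) = 0"
proof -
  define C where "C i j k = kaehler_form (D2 (b i) x (b k)) (D x (b j))" for i j k
  let ?e = "\<lambda>i. D x (b i)"
  \<comment> \<open>This is the derivative in direction \<open>b k\<close> of the identity
    \<open>kaehler_form (D y (b i)) (D y (b j)) = 0\<close>.\<close>
  have swap12: "C i j k = C j i k" for i j k
  proof -
    have "kaehler_form (D x (b i)) (D2 (b j) x (b k)) + kaehler_form (D2 (b i) x (b k)) (D x (b j)) = 0"
      by (rule has_derivative_locally_zero[OF assms(1,2)
            has_derivative_kaehler_form[OF D2[OF \<open>x \<in> V\<close>] D2[OF \<open>x \<in> V\<close>]] lag])
    then show ?thesis
      unfolding C_def kaehler_form_commute[of "D x (b i)"] by simp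
  qed
  have swap13: "C i j k = C k j i" for i j k
    unfolding C_def using symmetric_second_derivative[OF assms(1,2) D D2 cont] by simp
  \<comment> \<open>The phase condition is differentiated in direction \<open>b k\<close>. Every
    summand is a Hermitian product times the volume of the frame, and that volume is real and
    nonzero, so the Hermitian products have real sum; their imaginary parts are
    \<open>- C i i k\<close>.\<close>
  have trace: "(\<Sum>i\<in>UNIV. C i i k) = 0"
  proof -
    have "Im (\<Sum>i\<in>UNIV. holomorphic_volume_form (?e(i := D2 (b i) x (b k)))) = 0"
      by (rule has_derivative_locally_zero[OF assms(1,2) bounded_linear.has_derivative[OF bounded_linear_Im
              has_derivative_holomorphic_volume_form[OF D2[OF \<open>x \<in> V\<close>]]] special])
    then have "Im ((\<Sum>i\<in>UNIV. hermitian (D2 (b i) x (b k)) (?e i)) * holomorphic_volume_form ?e) = 0"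
      using holomorphic_volume_form_upd[of ?e, OF orth lag[OF \<open>x \<in> V\<close>]]
      by (simp add: sum_distrib_right)
    moreover have "Im (holomorphic_volume_form ?e) = 0" "holomorphic_volume_form ?e \<noteq> 0"
      using special[OF \<open>x \<in> V\<close>] holomorphic_volume_form_frame_nonzero[of ?e, OF orth lag[OF \<open>x \<in> V\<close>]]
      by auto
    ultimately have "Im (\<Sum>i\<in>UNIV. hermitian (D2 (b i) x (b k)) (?e i)) = 0"
      by (auto simp: complex_eq_iff)
    then show ?thesis
      by (simp add: hermitian_eq C_def sum_negf)
  qed
  \<comment> \<open>The goal contracts the outer slots of the cubic form, the trace identity the
    first two; both pass through \<open>C k i i\<close>.\<close>
  have "C i k i = C i i k" for i
    by (metis swap12 swap13)
  then show ?thesis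
    using trace by (simp add: kaehler_form_sum_left C_def)
qed

section \<open>Tangent frames and local minima\<close>

lemma velocity_in_tangent_space:
  assumes "open V" "x \<in> V" "(\<phi> has_derivative D) (at x)" "\<phi> ` V \<subseteq> L"
  shows "D b \<in> tangent_space L (\<phi> x)"
proof -
  \<comment> \<open>\<open>tangent_space\<close> demands a curve that lies in \<open>L\<close> at
    all real times, so the image of the parameter line is replaced by the constant
    \<open>\<phi> x\<close> wherever the line has left \<open>V\<close>. Near time 0 nothing
    changes.\<close>
  let ?\<gamma> = "\<lambda>t. if x + t *\<^sub>R b \<in> V then \<phi> (x + t *\<^sub>R b) else \<phi> x"
  have op: "open ((\<lambda>t::real. x + t *\<^sub>R b) -` V)"
    by (rule open_vimage[OF \<open>open V\<close>]) (auto intro!: continuous_intros)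
  have "((\<lambda>t::real. \<phi> (x + t *\<^sub>R b)) has_derivative (\<lambda>h. D (h *\<^sub>R b))) (at 0)"
    by (rule has_derivative_compose[where g = \<phi>])
      (use assms in \<open>auto intro!: derivative_eq_intros\<close>)
  then have "((\<lambda>t. \<phi> (x + t *\<^sub>R b)) has_vector_derivative D b) (at 0)"
    unfolding has_vector_derivative_def linear_scale[OF has_derivative_linear[OF assms(3)]] .
  then have "(?\<gamma> has_vector_derivative D b) (at 0)"
    by (rule has_vector_derivative_transform_within_open[OF _ op]) (use assms in auto)
  moreover have "?\<gamma> 0 = \<phi> x" "\<forall>t. ?\<gamma> t \<in> L" using assms by auto
  ultimately show ?thesis
    unfolding tangent_space_def by (intro CollectI exI[of _ ?\<gamma>] conjI)
qed

text \<open>An orthonormal basis of the image is pulled back. With \<open>T\<close> the derivative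
  of a chart this yields parameter directions whose images are an orthonormal tangent frame.\<close>

lemma injective_linear_orthonormal_frame:
  fixes T :: "real ^ 'n \<Rightarrow> 'b::euclidean_space"
  assumes "linear T" "inj T"
  shows "\<exists>b :: 'n \<Rightarrow> real ^ 'n. \<forall>i j. T (b i) \<bullet> T (b j) = (if i = j then 1 else 0)"
proof -
  have dim: "dim (range T) = CARD('n)"
    using dim_image_eq[OF \<open>linear T\<close>, of UNIV] \<open>inj T\<close> by (simp add: dim_UNIV)
  obtain B where B: "B \<subseteq> range T" "pairwise orthogonal B" "\<And>v. v \<in> B \<Longrightarrow> norm v = 1"
    "independent B" "card B = CARD('n)"
    using orthonormal_basis_subspace[OF linear_subspace_image[OF \<open>linear T\<close> subspace_UNIV]] dim
    by metis
  obtain f where f: "bij_betw f (UNIV :: 'n set) B"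
    using finite_same_card_bij[OF finite_class.finite_UNIV independent_imp_finite[OF B(4)]] B(5)
    by metis
  then have fB: "f i \<in> B" for i by (auto simp: bij_betw_def)
  define b where "b i = inv T (f i)" for i
  have Tb: "T (b i) = f i" for i
    using fB[of i] B(1) by (auto simp: b_def f_inv_into_f)
  show ?thesis
  proof (intro exI[of _ b] allI)
    fix i j
    show "T (b i) \<bullet> T (b j) = (if i = j then 1 else 0)"
    proof (cases "i = j")
      case True
      then show ?thesis using B(3)[OF fB[of j]] by (simp add: Tb dot_square_norm)
    next
      case False
      then have "f i \<noteq> f j" using f by (auto simp: bij_betw_def inj_on_def)
      then show ?thesis
        using B(2) fB False by (auto simp: Tb pairwise_def orthogonal_def)
    qed
  qed
qed

text \<open>If \<open>d\<close> were negative, \<open>h'\<close> would be negative just to the right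
  of its zero at 0, and by the mean value theorem \<open>h\<close> would drop below
  \<open>h 0\<close>.\<close>

lemma local_min_second_derivative:
  fixes h :: "real \<Rightarrow> real"
  assumes "r > 0"
    and h': "\<And>t. \<bar>t\<bar> < r \<Longrightarrow> (h has_real_derivative h' t) (at t)"
    and h'': "(h' has_real_derivative d) (at 0)"
    and min: "\<And>t. \<bar>t\<bar> < r \<Longrightarrow> h 0 \<le> h t"
  shows "h' 0 = 0" and "d \<ge> 0"
proof -
  show h0: "h' 0 = 0"
    by (rule DERIV_local_min[OF h' \<open>r > 0\<close>]) (use \<open>r > 0\<close> min in auto)
  show "d \<ge> 0"
  proof (rule ccontr)
    assume "\<not> d \<ge> 0"
    then obtain s where s: "s > 0" "\<And>t. 0 < t \<Longrightarrow> t < s \<Longrightarrow> h' t < 0"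
      using DERIV_neg_dec_right[OF h''] h0 by force
    define t where "t = min r s / 2"
    have t: "0 < t" "t < r" "t < s" using \<open>r > 0\<close> s(1) by (auto simp: t_def)
    obtain z where z: "0 < z" "z < t" "h t - h 0 = (t - 0) * h' z"
      using MVT2[OF t(1), of h h'] h' t by force
    have "t * h' z < 0" using s(2)[of z] z t by (simp add: mult_pos_neg)
    then show False using min[of t] z t by simp
  qed
qed

text \<open>The Laplacian appears as a sum of second derivatives along the parameter lines in the
  directions \<open>b i\<close>. These lines need not map to geodesics: at a minimum the first
  derivatives along \<open>L\<close> vanish, so the second derivative along a curve depends only on
  its velocity.\<close>

lemma special_lagrangian_no_local_min:
  fixes L :: "(complex ^ 'n) set"
  assumes sl: "special_lagrangian L" and "q \<in> L" "\<epsilon> > 0" and "open U" "q \<in> U"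
    and min: "\<And>z. z \<in> L \<inter> U \<Longrightarrow> c \<bullet> q - \<epsilon> * (q \<bullet> q) \<le> c \<bullet> z - \<epsilon> * (z \<bullet> z)"
  shows False
proof -
  obtain U' and V :: "(real ^ 'n) set" and \<phi> \<psi> where "q \<in> U'" "open V"
    and hom: "homeomorphism V (L \<inter> U') \<phi> \<psi>" and smooth: "smooth_on V \<phi>"
    and inj: "\<And>y. y \<in> V \<Longrightarrow> inj (frechet_derivative \<phi> (at y))"
    using sl \<open>q \<in> L\<close> unfolding special_lagrangian_def embedded_submanifold_def by metis
  define x where "x = \<psi> q"
  define D where "D y = frechet_derivative \<phi> (at y)" for y
  define D2 where "D2 v y = frechet_derivative (\<lambda>z. D z v) (at y)" for v y
  have x: "x \<in> V" "\<phi> x = q"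
    using hom \<open>q \<in> L\<close> \<open>q \<in> U'\<close> by (auto simp: homeomorphism_def x_def)
  have \<phi>L: "\<phi> ` V \<subseteq> L" using hom by (auto simp: homeomorphism_def)
  have "Ck_on (Suc (Suc 0)) \<phi> V" using smooth unfolding smooth_on_def by blast
  then have D: "(\<phi> has_derivative D y) (at y)"
    and D2: "((\<lambda>z. D z v) has_derivative D2 v y) (at y)"
    and cont: "continuous_on V (\<lambda>y. D2 v y u)" if "y \<in> V" for y u v
    using that by (auto simp: D_def D2_def frechet_derivative_works)
  have tangent: "D y v \<in> tangent_space L (\<phi> y)" if "y \<in> V" for y v
    by (rule velocity_in_tangent_space[OF \<open>open V\<close> that D[OF that] \<phi>L])
  have lag: "kaehler_form (D y u) (D y v) = 0" if "y \<in> V" for y u v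
    using sl tangent[OF that] \<phi>L that unfolding special_lagrangian_def by blast
  have special: "Im (holomorphic_volume_form (\<lambda>i. D y (v i))) = 0" if "y \<in> V" for y v
  proof -
    have "\<forall>v. (\<forall>i. v i \<in> tangent_space L (\<phi> y)) \<longrightarrow> Im (holomorphic_volume_form v) = 0"
      using sl \<phi>L that by (auto simp: special_lagrangian_def)
    from spec[OF this, of "\<lambda>i. D y (v i)"] tangent[OF that] show ?thesis by simp
  qed
  have "inj (D x)" using inj[OF x(1)] by (simp add: D_def)
  from injective_linear_orthonormal_frame[OF has_derivative_linear[OF D[OF x(1)]] this]
  obtain b :: "'n \<Rightarrow> real ^ 'n" where orth: "\<And>i j. D x (b i) \<bullet> D x (b j) = (if i = j then 1 else 0)"
    by auto
  \<comment> \<open>The ambient gradient of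
    \<open>c \<bullet> z - \<epsilon> * (z \<bullet> z)\<close> at \<open>q\<close>. The first-order
    condition makes it normal to the frame; the second-order condition bounds its product with each
    second derivative from below.\<close>
  define N where "N = c - (2 * \<epsilon>) *\<^sub>R q"
  have N: "N \<bullet> D x (b i) = 0 \<and> 2 * \<epsilon> \<le> N \<bullet> D2 (b i) x (b i)" for i
  proof -
    let ?l = "\<lambda>t. x + t *\<^sub>R b i"
    let ?h' = "\<lambda>t. (c - (2 * \<epsilon>) *\<^sub>R \<phi> (?l t)) \<bullet> D (?l t) (b i)"
    have "continuous_on V \<phi>" using hom by (simp add: homeomorphism_def)
    then have "open (V \<inter> \<phi> -` U)"
      using \<open>open V\<close> \<open>open U\<close> by (simp add: continuous_on_open_vimage Int_commute)
    then have "open (?l -` (V \<inter> \<phi> -` U))"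
      by (rule open_vimage) (auto intro!: continuous_intros)
    moreover have "0 \<in> ?l -` (V \<inter> \<phi> -` U)" using x \<open>q \<in> U\<close> by simp
    ultimately obtain r where "r > 0" and r: "ball 0 r \<subseteq> ?l -` (V \<inter> \<phi> -` U)"
      by (rule openE)
    have l: "?l t \<in> V" "\<phi> (?l t) \<in> L \<inter> U" if "\<bar>t\<bar> < r" for t
      using r that \<phi>L by (auto simp: subset_eq)
    have vd: "((\<lambda>t. F (?l t)) has_vector_derivative F' (b i)) (at t)"
      if "(F has_derivative F') (at (?l t))" for t and F F' :: "real ^ 'n \<Rightarrow> complex ^ 'n"
    proof -
      have "((\<lambda>t. F (?l t)) has_derivative (\<lambda>h. F' (h *\<^sub>R b i))) (at t)"
        by (rule has_derivative_compose[where g = F])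
          (use that in \<open>auto intro!: derivative_eq_intros\<close>)
      then show ?thesis
        unfolding has_vector_derivative_def linear_scale[OF has_derivative_linear[OF that]] .
    qed
    have inner: "((\<lambda>t. F t \<bullet> G t) has_real_derivative F t \<bullet> G' + F' \<bullet> G t) (at t)"
      if "(F has_vector_derivative F') (at t)" "(G has_vector_derivative G') (at t)"
      for t F' G' and F G :: "real \<Rightarrow> complex ^ 'n"
      unfolding has_field_derivative_def
      by (rule has_derivative_eq_rhs[OF has_derivative_inner[OF that[unfolded has_vector_derivative_def]]])
        (simp add: fun_eq_iff algebra_simps)
    have d1: "((\<lambda>t. c \<bullet> \<phi> (?l t) - \<epsilon> * (\<phi> (?l t) \<bullet> \<phi> (?l t))) has_real_derivative ?h' t) (at t)"
      if "\<bar>t\<bar> < r" for t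
    proof -
      note v = vd[OF D[OF l(1)[OF that]]]
      show ?thesis
        using DERIV_diff[OF inner[OF has_vector_derivative_const v] DERIV_cmult[OF inner[OF v v]], of c \<epsilon>]
        by (simp add: algebra_simps inner_commute)
    qed
    \<comment> \<open>The term \<open>- 2 * \<epsilon>\<close> comes from differentiating the first
      factor of \<open>?h'\<close>, since \<open>D x (b i)\<close> is a unit vector.\<close>
    have d2: "(?h' has_real_derivative N \<bullet> D2 (b i) x (b i) - 2 * \<epsilon>) (at 0)"
    proof -
      have \<phi>': "((\<lambda>t. \<phi> (?l t)) has_vector_derivative D x (b i)) (at 0)"
        using vd[of \<phi> "D x" 0] D[OF x(1)] by simp
      have "((\<lambda>t. c - (2 * \<epsilon>) *\<^sub>R \<phi> (?l t)) has_vector_derivative - ((2 * \<epsilon>) *\<^sub>R D x (b i))) (at 0)"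
        by (auto intro!: derivative_eq_intros \<phi>')
      from inner[OF this, of "\<lambda>t. D (?l t) (b i)" "D2 (b i) x (b i)"]
      show ?thesis
        using vd[of "\<lambda>z. D z (b i)" "D2 (b i) x" 0] D2[OF x(1)] x(2) orth[of i i]
        by (simp add: N_def)
    qed
    have m: "c \<bullet> \<phi> (?l 0) - \<epsilon> * (\<phi> (?l 0) \<bullet> \<phi> (?l 0)) \<le> c \<bullet> \<phi> (?l t) - \<epsilon> * (\<phi> (?l t) \<bullet> \<phi> (?l t))"
      if "\<bar>t\<bar> < r" for t
      using min[OF l(2)[OF that]] x by simp
    show ?thesis
      using local_min_second_derivative[OF \<open>r > 0\<close> d1 d2 m] x(2) by (simp add: N_def)
  qed
  \<comment> \<open>The summed second derivatives are \<omega>-orthogonal to the frame, hence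
    tangent, while \<open>N\<close> is normal. Summing the lower bounds would make the same product
    strictly positive, as the index type is nonempty.\<close>
  have "N \<bullet> (\<Sum>i\<in>UNIV. D2 (b i) x (b i)) = 0"
    by (rule lagrangian_frame_complement[of "\<lambda>i. D x (b i)", OF orth lag[OF x(1)]])
      (use N special_lagrangian_mean_curvature_tangent[OF \<open>open V\<close> x(1) D D2 cont lag special orth] x
        in auto)
  moreover have "(\<Sum>i\<in>(UNIV :: 'n set). 2 * \<epsilon>) \<le> N \<bullet> (\<Sum>i\<in>UNIV. D2 (b i) x (b i))"
    unfolding inner_sum_right by (rule sum_mono) (use N in blast)
  ultimately show False using \<open>\<epsilon> > 0\<close> by (simp add: zero_less_mult_iff mult_le_0_iff)
qed

section \<open>Properness on the cone region and conclusion\<close>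

text \<open>Each coordinate is smaller than \<open>cmod (z $ k) / \<delta>\<close>, and the sector
  bounds \<open>cmod (z $ k)\<close> by \<open>Re (z $ k) / cos \<theta>\<close>. The estimate is
  what makes sublevel sets of \<open>Re (z $ k)\<close> bounded.\<close>

lemma cone_region_norm_le:
  fixes k :: "'n::finite"
  assumes "\<delta> > 0" "0 < \<theta>" "\<theta> < pi / 2"
  obtains K where "\<And>z. z \<in> cone_region k \<theta> \<delta> \<Longrightarrow> 0 < Re (z $ k) \<and> norm z \<le> K * Re (z $ k)"
proof (rule that)
  fix z :: "complex ^ 'n"
  assume z: "z \<in> cone_region k \<theta> \<delta>"
  then obtain r \<rho> where r: "z $ k = rcis r \<rho>" "r > 0" "0 < \<rho>" "\<rho> < \<theta>"
    by (auto simp: cone_region_def sector_def)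
  have c: "0 < cos \<theta>" using assms by (intro cos_gt_zero) auto
  have "cos \<theta> \<le> cos \<rho>" using r assms by (intro cos_monotone_0_pi_le) auto
  then have Re: "r * cos \<theta> \<le> Re (z $ k)" using r by simp
  then show "0 < Re (z $ k) \<and> norm z \<le> (real CARD('n) / (\<delta> * cos \<theta>)) * Re (z $ k)"
  proof (intro conjI)
    show "0 < Re (z $ k)" using Re c r(2) by (meson less_le_trans mult_pos_pos)
    have "norm z \<le> (\<Sum>i\<in>UNIV. norm (z $ i))" by (simp add: norm_vec_def L2_set_le_sum)
    also have "\<dots> \<le> (\<Sum>i\<in>(UNIV :: 'n set). r / \<delta>)"
    proof (rule sum_mono)
      fix i
      have "\<delta> * cmod (z $ i) < r" using z r by (auto simp: cone_region_def)
      then show "norm (z $ i) \<le> r / \<delta>" using \<open>\<delta> > 0\<close> by (simp add: field_simps)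
    qed
    also have "\<dots> = (real CARD('n) / (\<delta> * cos \<theta>)) * (r * cos \<theta>)" using c by simp
    also have "\<dots> \<le> (real CARD('n) / (\<delta> * cos \<theta>)) * Re (z $ k)"
      using Re c \<open>\<delta> > 0\<close> by (intro mult_left_mono) auto
    finally show "norm z \<le> (real CARD('n) / (\<delta> * cos \<theta>)) * Re (z $ k)" .
  qed
qed

theorem theorem3p4p2:
  fixes L \<Lambda> :: "(complex ^ 'n) set" and k :: 'n and \<delta> \<theta> :: real
  assumes "special_lagrangian L" and "closed L" and "L \<noteq> {}"
    and "asymptotic_to_cone L \<Lambda>"
    and "\<delta> > 0" and "0 < \<theta>" and "\<theta> < pi / (2 * real CARD('n))"
  shows "\<not> L \<subseteq> cone_region k \<theta> \<delta>"
proof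
  assume sub: "L \<subseteq> cone_region k \<theta> \<delta>"
  have "pi / (2 * real CARD('n)) \<le> pi / 2"
    by (intro divide_left_mono) (auto simp: Suc_leI)
  then have "\<theta> < pi / 2" using assms(7) by simp
  then obtain K where K: "\<And>z. z \<in> L \<Longrightarrow> 0 < Re (z $ k)" "\<And>z. z \<in> L \<Longrightarrow> norm z \<le> K * Re (z $ k)"
    using cone_region_norm_le[OF \<open>\<delta> > 0\<close> \<open>0 < \<theta>\<close>, of k] sub by (metis subsetD)
  define c :: "complex ^ 'n" where "c = axis k 1"
  have c: "c \<bullet> z = Re (z $ k)" for z
    by (simp add: c_def inner_axis' inner_complex_def)
  obtain p where "p \<in> L" using \<open>L \<noteq> {}\<close> by blast
  \<comment> \<open>The sublevel set \<open>S\<close> leaves one unit of room above the value at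
    \<open>p\<close>. With \<epsilon> chosen so that the quadratic term stays below 1 on
    \<open>S\<close>, comparison with \<open>p\<close> keeps the minimiser off the level
    \<open>m\<close>.\<close>
  define m where "m = c \<bullet> p + 1"
  define S where "S = L \<inter> {z. c \<bullet> z \<le> m}"
  define R where "R = \<bar>K\<bar> * m"
  have R: "norm z \<le> R" if "z \<in> S" for z
  proof -
    have "norm z \<le> \<bar>K\<bar> * Re (z $ k)"
      using K[of z] that by (auto simp: S_def intro: order_trans[OF _ mult_right_mono])
    also have "\<dots> \<le> R" using that by (auto simp: S_def R_def c intro: mult_left_mono)
    finally show ?thesis .
  qed
  have "compact S"
    unfolding compact_eq_bounded_closed
    using R \<open>closed L\<close> by (auto simp: S_def bounded_iff intro!: closed_Int closed_halfspace_le)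
  have "p \<in> S" using \<open>p \<in> L\<close> by (simp add: S_def m_def)
  define \<epsilon> where "\<epsilon> = 1 / (R\<^sup>2 + 1)"
  have "\<epsilon> > 0" by (simp add: \<epsilon>_def add_nonneg_pos)
  have \<epsilon>: "\<epsilon> * (z \<bullet> z) < 1" if "z \<in> S" for z
  proof -
    have "z \<bullet> z \<le> R\<^sup>2" using R[OF that] by (simp add: dot_square_norm power_mono)
    then show ?thesis by (simp add: \<epsilon>_def add_nonneg_pos)
  qed
  have "continuous_on S (\<lambda>z. c \<bullet> z - \<epsilon> * (z \<bullet> z))" by (intro continuous_intros)
  then obtain q where "q \<in> S"
    and q: "\<And>z. z \<in> S \<Longrightarrow> c \<bullet> q - \<epsilon> * (q \<bullet> q) \<le> c \<bullet> z - \<epsilon> * (z \<bullet> z)"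
    using continuous_attains_inf[OF \<open>compact S\<close>] \<open>p \<in> S\<close> by blast
  have "0 \<le> \<epsilon> * (p \<bullet> p)" using \<open>\<epsilon> > 0\<close> by simp
  then have "c \<bullet> q < m"
    using q[OF \<open>p \<in> S\<close>] \<epsilon>[OF \<open>q \<in> S\<close>] unfolding m_def by linarith
  \<comment> \<open>The open half-space below level \<open>m\<close> serves as the neighbourhood of
    \<open>q\<close>: its intersection with \<open>L\<close> lies in \<open>S\<close>, where
    \<open>q\<close> is a minimiser.\<close>
  show False
    by (rule special_lagrangian_no_local_min[where c = c, OF assms(1) _ \<open>\<epsilon> > 0\<close> open_halfspace_lt[of c m]])
      (use \<open>q \<in> S\<close> \<open>c \<bullet> q < m\<close> q in \<open>auto simp: S_def\<close>)
qed

end
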